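(* Let $S_I=\bigcap_{i=1}^{N_h}S_i$ and suppose that, for every $x\in S_I$, the transversality condition holds for the pair $(S_i,S_j)$ for all $i,j\in I(x)$. Suppose there exists a bounded, open domain $D\subseteq\widehat\Omega$ such that $S_I\subset D$ (and let $\hat\gamma$ satisfy $0<\hat\gamma<\inf_{x\in D}R_C(\widehat K(x))$). If $x_0=x(0)\in S_I$, then any Lebesgue measurable control input $u(t)\in\widehat K_{\hat\gamma}(x(t))$ renders the pair $(S_I,\widehat G_{\hat\gamma})$ strongly invariant; i.e. $x(t)\in S_I$ for all $t\ge0$.
   Context: System: $\dot x=f(x)+g(x)u$, $u\in\mathcal U\subset\mathbb R^m$, with $f:\mathbb R^n\to\mathbb R^n$ and $g:\mathbb R^n\to\mathbb R^{n\times m}$ locally Lipschitz. $\mathcal U=\{u\in\mathbb R^m: A_uu\le b_u\}$, with constant $A_u\in\mathbb R^{p\times m}$, $b_u\in\mathbb R^p$, is a compact convex polytope with nonempty interior. $\|\cdot\|$ is a sub-multiplicative matrix norm. Sets: for $i=1,\dots,N_h$, $h_i:\mathbb R^n\to\mathbb R$ is continuously differentiable with locally Lipschitz gradient; $S_i=\{x:h_i(x)\le0\}$ is compact, with $\operatorname{int}(S_i)=\{h_i<0\}$ and $\partial S_i=\{h_i=0\}$. Each $h_i$ is a strict control barrier function: $\inf_{u\in\mathcal U}[L_fh_i(x)+L_gh_i(x)u]<0$ for all $x\in\partial S_i$, where $L_fh=\frac{\partial h}{\partial x}f$ and $L_gh=\frac{\partial h}{\partial x}g$. Maps: $\alpha_i:\mathbb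 R\to\mathbb R$ are locally Lipschitz extended class-$\mathcal K_\infty$ functions (continuous, strictly increasing, $\alpha_i(0)=0$, $\alpha_i(s)\to\pm\infty$ as $s\to\pm\infty$). Define $$\widehat K(x)=\{u\in\mathbb R^m: A_uu\le b_u,\ L_gh_i(x)u\le-\alpha_i(h_i(x))-L_fh_i(x),\ i=1,\dots,N_h\},$$ $\widehat\Omega=\{x\in\mathbb R^n:\operatorname{int}(\widehat K(x))\ne\emptyset\}$. For $A\subset\mathbb R^m$, $R_C(A)=\sup_{u\in A}d_{A^c}(u)$, where $A^c=\mathbb R^m\setminus A$ and $d_A(u)=\inf_{a\in A}\|u-a\|$. $\widehat K_{\hat\gamma}(x)=\operatorname{int}(\widehat K(x))-\hat\gamma B(0,1)=\{u\in\widehat K(x): d_{\mathbb R^m\setminus\widehat K(x)}(u)\ge\hat\gamma\}$ (Minkowski difference $U_1-U_2=(U_1^c+U_2)^c$, $B(0,1)$ the open unit ball), and $\widehat G_{\hat\gamma}(x)=\{f(x)+g(x)u:u\in\widehat K_{\hat\gamma}(x)\}$. Transversality: the Clarke tangent cone of $S$ at $x$ is $T_S(x)=\{v:\limsup_{y\to x,\,t\downarrow0}\frac{d_S(y+tv)-d_S(y)}{t}\le0\}$, and the normal cone is its polar, $N_S(x)=\{y:\langle y,v\rangle\le0\ \forall v\in T_S(x)\}$. Transversality holds for a pair $(S_1,S_2)$ of closed sets if $N_{S_1}(x)\cap(-N_{S_2}(x))=\{0\}$ for all $x\in\partial S_1\cap\partial S_2$. $I(x)=\{i:\exists j\ne i,\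 h_i(x)=h_j(x)=0\}$. Strong invariance: for a differential inclusion $\dot x\in F(x)$ and $S\subset\mathbb R^n$, the pair $(S,F)$ is strongly invariant if all trajectories $x(\cdot)$ (absolutely continuous, satisfying the inclusion a.e.) with $x(0)\in S$ satisfy $x(t)\in S$ for all $t\ge0$. Here $x(\cdot)$ is a trajectory of $\dot x\in\widehat G_{\hat\gamma}(x)$. *)

theory Defs
  imports "HOL-Analysis.Analysis" "HOL-Library.Set_Algebras"
begin

definition locally_lipschitz :: "('a::metric_space \<Rightarrow> 'b::metric_space) \<Rightarrow> bool" where
  "locally_lipschitz F \<longleftrightarrow> local_lipschitz (UNIV :: real set) UNIV (\<lambda>_. F)"

definition gradient :: "('a::euclidean_space \<Rightarrow> real) \<Rightarrow> 'a \<Rightarrow> 'a" where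
  "gradient h x = (THE D. GDERIV h x :> D)"

lemma GDERIV_gradient:
  assumes "h differentiable at x"
  shows "GDERIV h x :> gradient h x"
proof -
  obtain h' where h': "(h has_derivative h') (at x)"
    using assms by (auto simp: differentiable_def)
  have lin: "linear h'"
    using h' by (rule has_derivative_linear)
  have "h' = (\<lambda>v. v \<bullet> adjoint h' 1)"
    using adjoint_works[OF lin, of _ 1] by auto
  then have "GDERIV h x :> adjoint h' 1"
    using h' unfolding gderiv_def by metis
  moreover have "D = D'" if "GDERIV h x :> D" "GDERIV h x :> D'" for D D'
  proof -
    have "(\<lambda>v. v \<bullet> D) = (\<lambda>v. v \<bullet> D')"
      using that has_derivative_unique unfolding gderiv_def by blast
    then show ?thesis
      by (metis vector_eq_ldot)
  qed
  ultimately show ?thesis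
    unfolding gradient_def by (rule_tac theI) auto
qed

definition extended_class_K_inf :: "(real \<Rightarrow> real) \<Rightarrow> bool" where
  "extended_class_K_inf \<alpha> \<longleftrightarrow>
     continuous_on UNIV \<alpha> \<and> strict_mono \<alpha> \<and> \<alpha> 0 = 0 \<and>
     filterlim \<alpha> at_top at_top \<and> filterlim \<alpha> at_bot at_bot"

definition lie_f :: "(real^'n \<Rightarrow> real^'n) \<Rightarrow> (real^'n \<Rightarrow> real) \<Rightarrow> real^'n \<Rightarrow> real" where
  "lie_f f h x = gradient h x \<bullet> f x"

definition lie_g :: "(real^'n \<Rightarrow> real^'m^'n) \<Rightarrow> (real^'n \<Rightarrow> real) \<Rightarrow> real^'n \<Rightarrow> real^'m" where
  "lie_g g h x = gradient h x v* g x"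

text \<open>The order on vectors is componentwise.\<close>

definition input_set :: "real^'m^'p \<Rightarrow> real^'p \<Rightarrow> (real^'m) set" where
  "input_set A\<^sub>u b\<^sub>u = {u. A\<^sub>u *v u \<le> b\<^sub>u}"

definition sublevel :: "('a \<Rightarrow> real) \<Rightarrow> 'a set" where
  "sublevel h = {x. h x \<le> 0}"

definition strict_cbf ::
  "(real^'m) set \<Rightarrow> (real^'n \<Rightarrow> real^'n) \<Rightarrow> (real^'n \<Rightarrow> real^'m^'n) \<Rightarrow> (real^'n \<Rightarrow> real) \<Rightarrow> bool" where
  "strict_cbf U f g h \<longleftrightarrow>
     (\<forall>x \<in> frontier (sublevel h). (INF u\<in>U. lie_f f h x + lie_g g h x \<bullet> u) < 0)"

definition K_hat ::
  "real^'m^'p \<Rightarrow> real^'p \<Rightarrow> (real^'n \<Rightarrow> real^'n) \<Rightarrow> (real^'n \<Rightarrow> real^'m^'n) \<Rightarrow>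
   nat \<Rightarrow> (nat \<Rightarrow> real^'n \<Rightarrow> real) \<Rightarrow> (nat \<Rightarrow> real \<Rightarrow> real) \<Rightarrow> real^'n \<Rightarrow> (real^'m) set" where
  "K_hat A\<^sub>u b\<^sub>u f g N h \<alpha> x =
     {u \<in> input_set A\<^sub>u b\<^sub>u.
        \<forall>i\<in>{1..N}. lie_g g (h i) x \<bullet> u \<le> - \<alpha> i (h i x) - lie_f f (h i) x}"

definition Omega_hat ::
  "real^'m^'p \<Rightarrow> real^'p \<Rightarrow> (real^'n \<Rightarrow> real^'n) \<Rightarrow> (real^'n \<Rightarrow> real^'m^'n) \<Rightarrow>
   nat \<Rightarrow> (nat \<Rightarrow> real^'n \<Rightarrow> real) \<Rightarrow> (nat \<Rightarrow> real \<Rightarrow> real) \<Rightarrow> (real^'n) set" where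
  "Omega_hat A\<^sub>u b\<^sub>u f g N h \<alpha> = {x. interior (K_hat A\<^sub>u b\<^sub>u f g N h \<alpha> x) \<noteq> {}}"

text \<open>
  The real-valued supremum and \<^const>\<open>infdist\<close> agree with the extended-valued ones whenever
  \<^term>\<open>A\<close> is nonempty and bounded.
\<close>

definition R_C :: "'a::euclidean_space set \<Rightarrow> real" where
  "R_C A = (SUP u\<in>A. infdist u (- A))"

definition minkowski_diff :: "'a::real_vector set \<Rightarrow> 'a set \<Rightarrow> 'a set" where
  "minkowski_diff U\<^sub>1 U\<^sub>2 = - ((- U\<^sub>1) + U\<^sub>2)"

lemma minkowski_diff_ball:
  fixes A :: "'a::euclidean_space set"
  assumes "A \<noteq> UNIV" "0 < \<gamma>"
  shows "minkowski_diff (interior A) ((*\<^sub>R) \<gamma> ` ball 0 1) = {u \<in> A. \<gamma> \<le> infdist u (- A)}"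
proof -
  have scaled: "(*\<^sub>R) \<gamma> ` ball 0 1 = ball (0::'a) \<gamma>"
    using assms(2) by (simp add: ball_scale)
  have diff: "u \<in> minkowski_diff (interior A) (ball 0 \<gamma>) \<longleftrightarrow> ball u \<gamma> \<subseteq> interior A" for u
  proof -
    have "u \<in> - interior A + ball 0 \<gamma> \<longleftrightarrow> (\<exists>a. a \<notin> interior A \<and> a \<in> ball u \<gamma>)"
    proof
      assume "u \<in> - interior A + ball 0 \<gamma>"
      then show "\<exists>a. a \<notin> interior A \<and> a \<in> ball u \<gamma>"
        by (auto simp: set_plus_def dist_norm)
    next
      assume "\<exists>a. a \<notin> interior A \<and> a \<in> ball u \<gamma>"
      then obtain a where "a \<notin> interior A" "u - a \<in> ball 0 \<gamma>"
        by (auto simp: dist_norm norm_minus_commute)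
      then show "u \<in> - interior A + ball 0 \<gamma>"
        by (metis ComplI diff_add_cancel add.commute set_plus_intro)
    qed
    then show ?thesis
      by (auto simp: minkowski_diff_def)
  qed
  have "ball u \<gamma> \<subseteq> interior A \<longleftrightarrow> u \<in> A \<and> \<gamma> \<le> infdist u (- A)" for u
  proof
    assume sub: "ball u \<gamma> \<subseteq> interior A"
    then have "u \<in> A"
      using assms(2) interior_subset by fastforce
    moreover have "\<gamma> \<le> dist u a" if "a \<in> - A" for a
      using that sub interior_subset by (meson ComplD in_mono mem_ball not_le)
    then have "\<gamma> \<le> infdist u (- A)"
      using assms(1) by (subst infdist_notempty) (auto intro!: cINF_greatest)
    ultimately show "u \<in> A \<and> \<gamma> \<le> infdist u (- A)" ..
  next
    assume "u \<in> A \<and> \<gamma> \<le> infdist u (- A)"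
    then have "ball u \<gamma> \<subseteq> A"
      by (smt (verit, ccfv_threshold) ComplI infdist_le mem_ball subsetI)
    then show "ball u \<gamma> \<subseteq> interior A"
      by (simp add: interior_maximal)
  qed
  then show ?thesis
    unfolding scaled using diff by auto
qed

definition K_hat_gamma ::
  "real^'m^'p \<Rightarrow> real^'p \<Rightarrow> (real^'n \<Rightarrow> real^'n) \<Rightarrow> (real^'n \<Rightarrow> real^'m^'n) \<Rightarrow>
   nat \<Rightarrow> (nat \<Rightarrow> real^'n \<Rightarrow> real) \<Rightarrow> (nat \<Rightarrow> real \<Rightarrow> real) \<Rightarrow> real \<Rightarrow> real^'n \<Rightarrow> (real^'m) set" where
  "K_hat_gamma A\<^sub>u b\<^sub>u f g N h \<alpha> \<gamma> x =
     minkowski_diff (interior (K_hat A\<^sub>u b\<^sub>u f g N h \<alpha> x)) ((*\<^sub>R) \<gamma> ` ball 0 1)"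

definition G_hat_gamma ::
  "real^'m^'p \<Rightarrow> real^'p \<Rightarrow> (real^'n \<Rightarrow> real^'n) \<Rightarrow> (real^'n \<Rightarrow> real^'m^'n) \<Rightarrow>
   nat \<Rightarrow> (nat \<Rightarrow> real^'n \<Rightarrow> real) \<Rightarrow> (nat \<Rightarrow> real \<Rightarrow> real) \<Rightarrow> real \<Rightarrow> real^'n \<Rightarrow> (real^'n) set" where
  "G_hat_gamma A\<^sub>u b\<^sub>u f g N h \<alpha> \<gamma> x =
     {f x + g x *v u | u. u \<in> K_hat_gamma A\<^sub>u b\<^sub>u f g N h \<alpha> \<gamma> x}"

definition clarke_tangent_cone :: "'a::euclidean_space set \<Rightarrow> 'a \<Rightarrow> 'a set" where
  "clarke_tangent_cone S x =
     {v. Limsup (nhds x \<times>\<^sub>F at_right 0)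
           (\<lambda>(y, t). ereal ((infdist (y + t *\<^sub>R v) S - infdist y S) / t)) \<le> 0}"

definition clarke_normal_cone :: "'a::euclidean_space set \<Rightarrow> 'a \<Rightarrow> 'a set" where
  "clarke_normal_cone S x = {y. \<forall>v \<in> clarke_tangent_cone S x. y \<bullet> v \<le> 0}"

definition transversal :: "'a::euclidean_space set \<Rightarrow> 'a set \<Rightarrow> bool" where
  "transversal S\<^sub>1 S\<^sub>2 \<longleftrightarrow>
     (\<forall>x \<in> frontier S\<^sub>1 \<inter> frontier S\<^sub>2.
        clarke_normal_cone S\<^sub>1 x \<inter> uminus ` clarke_normal_cone S\<^sub>2 x = {0})"

definition jointly_active :: "nat \<Rightarrow> (nat \<Rightarrow> 'a \<Rightarrow> real) \<Rightarrow> 'a \<Rightarrow> nat set" where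
  "jointly_active N h x = {i \<in> {1..N}. \<exists>j \<in> {1..N}. j \<noteq> i \<and> h i x = 0 \<and> h j x = 0}"

definition abs_continuous_on :: "real set \<Rightarrow> (real \<Rightarrow> 'a::real_normed_vector) \<Rightarrow> bool" where
  "abs_continuous_on I x \<longleftrightarrow>
     (\<forall>\<epsilon>>0. \<exists>\<delta>>0. \<forall>\<D>. \<D> division_of \<Union>\<D> \<and> \<Union>\<D> \<subseteq> I \<and> (\<Sum>K\<in>\<D>. Sup K - Inf K) < \<delta> \<longrightarrow>
        (\<Sum>K\<in>\<D>. norm (x (Sup K) - x (Inf K))) < \<epsilon>)"

text \<open>
  Trajectories live on an interval of times starting at 0: either all of \<open>{0..}\<close>, or a bounded
  interval \<open>{0..<T}\<close> or \<open>{0..T}\<close> when the trajectory is not defined for all times.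
\<close>

definition time_interval :: "real set \<Rightarrow> bool" where
  "time_interval J \<longleftrightarrow> is_interval J \<and> 0 \<in> J \<and> J \<subseteq> {0..}"

definition loc_abs_continuous_on :: "real set \<Rightarrow> (real \<Rightarrow> 'a::real_normed_vector) \<Rightarrow> bool" where
  "loc_abs_continuous_on J x \<longleftrightarrow> (\<forall>a b. {a..b} \<subseteq> J \<longrightarrow> abs_continuous_on {a..b} x)"

definition inclusion_trajectory ::
  "('a::euclidean_space \<Rightarrow> 'a set) \<Rightarrow> real set \<Rightarrow> (real \<Rightarrow> 'a) \<Rightarrow> bool" where
  "inclusion_trajectory F J x \<longleftrightarrow>
     loc_abs_continuous_on J x \<and>
     (AE t in lebesgue. t \<in> J \<longrightarrow> (\<exists>v \<in> F (x t). (x has_vector_derivative v) (at t within J)))"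

definition strongly_invariant :: "'a::euclidean_space set \<Rightarrow> ('a \<Rightarrow> 'a set) \<Rightarrow> bool" where
  "strongly_invariant S F \<longleftrightarrow>
     (\<forall>J x. time_interval J \<longrightarrow> inclusion_trajectory F J x \<longrightarrow> x 0 \<in> S \<longrightarrow> (\<forall>t\<in>J. x t \<in> S))"

definition control_trajectory ::
  "(real^'n \<Rightarrow> real^'n) \<Rightarrow> (real^'n \<Rightarrow> real^'m^'n) \<Rightarrow> real set \<Rightarrow>
   (real \<Rightarrow> real^'m) \<Rightarrow> (real \<Rightarrow> real^'n) \<Rightarrow> bool" where
  "control_trajectory f g J u x \<longleftrightarrow>
     loc_abs_continuous_on J x \<and>
     (AE t in lebesgue. t \<in> J \<longrightarrow>
        (x has_vector_derivative f (x t) + g (x t) *v u t) (at t within J))"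

end

(*
  Along a trajectory every barrier satisfies (h_i o x)' <= - alpha_i (h_i o x) almost everywhere,
  because the eroded control set lies inside K_hat. After the last time at which h_i o x <= 0 this
  derivative is therefore negative, while h_i o x is absolutely continuous (h_i is Lipschitz on the
  compact range of x), so h_i o x cannot become positive.
*)
theory Submission
  imports Defs
begin

section \<open>Absolute continuity: consequences and Lipschitz composition\<close>

lemma abs_continuous_onE:
  assumes "abs_continuous_on I x" "0 < \<epsilon>"
  obtains \<delta> where "\<delta> > 0" "\<And>\<D>. \<D> division_of \<Union>\<D> \<Longrightarrow> \<Union>\<D> \<subseteq> I \<Longrightarrow>
    (\<Sum>K\<in>\<D>. Sup K - Inf K) < \<delta> \<Longrightarrow> (\<Sum>K\<in>\<D>. norm (x (Sup K) - x (Inf K))) < \<epsilon>"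
proof -
  obtain \<delta> where "\<delta> > 0" "\<forall>\<D>. \<D> division_of \<Union>\<D> \<and> \<Union>\<D> \<subseteq> I \<and> (\<Sum>K\<in>\<D>. Sup K - Inf K) < \<delta> \<longrightarrow>
      (\<Sum>K\<in>\<D>. norm (x (Sup K) - x (Inf K))) < \<epsilon>"
    using assms(1)[unfolded abs_continuous_on_def, rule_format, OF assms(2)] by (elim exE conjE)
  then show thesis
    by (intro that[of \<delta>]) simp_all
qed

lemma abs_continuous_on_imp_continuous_on:
  assumes "abs_continuous_on {a..b} x"
  shows "continuous_on {a..b} x"
  unfolding continuous_on_iff
proof (intro ballI allI impI)
  fix s and \<epsilon> :: real
  assume s: "s \<in> {a..b}" and "0 < \<epsilon>"
  then obtain \<delta> where "\<delta> > 0" and \<delta>: "\<And>\<D>. \<D> division_of \<Union>\<D> \<Longrightarrow> \<Union>\<D> \<subseteq> {a..b} \<Longrightarrow>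
      (\<Sum>K\<in>\<D>. Sup K - Inf K) < \<delta> \<Longrightarrow> (\<Sum>K\<in>\<D>. norm (x (Sup K) - x (Inf K))) < \<epsilon>"
    using abs_continuous_onE[OF assms] by blast
  \<comment> \<open>A single interval \<open>{u..v}\<close> is a division of itself, so the modulus
    for sums bounds one increment.\<close>
  have close: "norm (x v - x u) < \<epsilon>" if "u \<le> v" "a \<le> u" "v \<le> b" "v - u < \<delta>" for u v
    using \<delta>[of "{{u..v}}"] that division_of_self[of u v] by (simp add: cbox_interval)
  have "dist (x t) (x s) < \<epsilon>" if "t \<in> {a..b}" "dist t s < \<delta>" for t
    using close[of s t] close[of t s] s that
    by (cases "s \<le> t") (auto simp: dist_norm norm_minus_commute)
  with \<open>\<delta> > 0\<close> show "\<exists>d>0. \<forall>t\<in>{a..b}. dist t s < d \<longrightarrow> dist (x t) (x s) < \<epsilon>"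
    by blast
qed

text \<open>A Lipschitz map stretches every increment by at most the factor \<open>L\<close>, so a
  modulus for \<open>x\<close> at a reduced tolerance serves for the composite. The Lipschitz
  condition is placed on the range of \<open>x\<close>, where compactness supplies it for a
  barrier.\<close>

lemma abs_continuous_on_lipschitz_compose:
  fixes x :: "real \<Rightarrow> 'a::real_normed_vector" and F :: "'a \<Rightarrow> 'b::real_normed_vector"
  assumes x: "abs_continuous_on {a..b} x" and F: "L-lipschitz_on (x ` {a..b}) F"
  shows "abs_continuous_on {a..b} (\<lambda>t. F (x t))"
  unfolding abs_continuous_on_def
proof (intro allI impI)
  fix \<epsilon> :: real
  assume "0 < \<epsilon>"
  have L: "0 \<le> L"
    using F by (rule lipschitz_on_nonneg)
  \<comment> \<open>Dividing by \<open>L + 1\<close> covers \<open>L = 0\<close> and keeps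
    \<open>L * (\<epsilon> / (L + 1))\<close> strictly below \<epsilon>.\<close>
  with \<open>0 < \<epsilon>\<close> have "0 < \<epsilon> / (L + 1)" by simp
  then obtain \<delta> where "\<delta> > 0" and \<delta>: "\<And>\<D>. \<D> division_of \<Union>\<D> \<Longrightarrow> \<Union>\<D> \<subseteq> {a..b} \<Longrightarrow>
      (\<Sum>K\<in>\<D>. Sup K - Inf K) < \<delta> \<Longrightarrow>
      (\<Sum>K\<in>\<D>. norm (x (Sup K) - x (Inf K))) < \<epsilon> / (L + 1)"
    using abs_continuous_onE[OF x] by blast
  have "(\<Sum>K\<in>\<D>. norm (F (x (Sup K)) - F (x (Inf K)))) < \<epsilon>"
    if div: "\<D> division_of \<Union>\<D>" and sub: "\<Union>\<D> \<subseteq> {a..b}"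
      and small: "(\<Sum>K\<in>\<D>. Sup K - Inf K) < \<delta>" for \<D>
  proof -
    have "norm (F (x (Sup K)) - F (x (Inf K))) \<le> L * norm (x (Sup K) - x (Inf K))"
      if KD: "K \<in> \<D>" for K
    proof -
      \<comment> \<open>Members of a division are nonempty, so \<open>Inf K\<close> and
        \<open>Sup K\<close> really are the endpoints \<open>u\<close> and \<open>v\<close>.\<close>
      obtain u v where "K = {u..v}" "u \<le> v"
        using division_ofD(3,4)[OF div KD] by (metis atLeastatMost_empty_iff2 box_real(2))
      moreover from this have "u \<in> {a..b}" "v \<in> {a..b}"
        using KD sub by fastforce+
      ultimately show ?thesis
        using lipschitz_onD[OF F, of "x v" "x u"] by (simp add: dist_norm)
    qed
    then have "(\<Sum>K\<in>\<D>. norm (F (x (Sup K)) - F (x (Inf K))))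
        \<le> L * (\<Sum>K\<in>\<D>. norm (x (Sup K) - x (Inf K)))"
      by (simp add: sum_distrib_left sum_mono)
    also have "\<dots> \<le> L * (\<epsilon> / (L + 1))"
      using L \<delta>[OF div sub small] by (intro mult_left_mono) auto
    also have "\<dots> < \<epsilon>"
      using L \<open>0 < \<epsilon>\<close> by (simp add: field_simps)
    finally show ?thesis .
  qed
  with \<open>\<delta> > 0\<close> show "\<exists>\<delta>>0. \<forall>\<D>. \<D> division_of \<Union>\<D> \<and> \<Union>\<D> \<subseteq> {a..b} \<and> (\<Sum>K\<in>\<D>. Sup K - Inf K) < \<delta> \<longrightarrow>
      (\<Sum>K\<in>\<D>. norm (F (x (Sup K)) - F (x (Inf K)))) < \<epsilon>"
    by blast
qed

section \<open>Monotonicity from the sign of the derivative almost everywhere\<close>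

text \<open>Because \<open>t\<close> lies between \<open>u\<close> and \<open>v\<close>, the
  linearization errors \<open>e * (v - t)\<close> and \<open>e * (t - u)\<close> add up to exactly
  \<open>e * (v - u)\<close>, while the linear part \<open>d * (v - u)\<close> is
  nonpositive.\<close>

lemma straddle_upper_bound:
  fixes \<phi> :: "real \<Rightarrow> real"
  assumes "(\<phi> has_real_derivative d) (at t within S)" "d \<le> 0" "0 < e"
  obtains r where "r > 0"
    "\<And>u v. u \<in> S \<Longrightarrow> v \<in> S \<Longrightarrow> u \<le> t \<Longrightarrow> t \<le> v \<Longrightarrow> t - u < r \<Longrightarrow> v - t < r \<Longrightarrow>
       \<phi> v - \<phi> u \<le> e * (v - u)"
proof -
  have "(\<phi> has_derivative (*) d) (at t within S)"
    using assms(1) by (simp add: has_field_derivative_def)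
  then obtain r where "r > 0" and r: "\<And>y. y \<in> S \<Longrightarrow> \<bar>y - t\<bar> < r \<Longrightarrow>
      \<bar>\<phi> y - \<phi> t - d * (y - t)\<bar> \<le> e * \<bar>y - t\<bar>"
    using \<open>0 < e\<close> unfolding has_derivative_within_alt real_norm_def by metis
  have "\<phi> v - \<phi> u \<le> e * (v - u)"
    if uv: "u \<in> S" "v \<in> S" "u \<le> t" "t \<le> v" "t - u < r" "v - t < r" for u v
  proof -
    have "\<phi> v - \<phi> t - d * (v - t) \<le> e * (v - t)" "- (\<phi> u - \<phi> t - d * (u - t)) \<le> e * (t - u)"
      using r[of v] r[of u] uv by auto
    moreover have "d * (v - u) \<le> 0"
      using \<open>d \<le> 0\<close> uv by (simp add: mult_nonpos_nonneg)
    ultimately show ?thesis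
      by (simp add: algebra_simps)
  qed
  with \<open>r > 0\<close> show thesis
    using that by blast
qed

text \<open>
  Telescope over a fine tagged division: the intervals tagged in the exceptional null set lie in an
  open set of small measure, so absolute continuity controls them; the others are controlled by
  the derivative at the tag.
\<close>

lemma abs_continuous_on_AE_deriv_nonpos_imp_le:
  fixes \<phi> :: "real \<Rightarrow> real"
  assumes "a \<le> b" and ac: "abs_continuous_on {a..b} \<phi>"
    and deriv: "AE t in lebesgue. t \<in> {a..b} \<longrightarrow>
      (\<exists>d\<le>0. (\<phi> has_real_derivative d) (at t within {a..b}))"
  shows "\<phi> b \<le> \<phi> a"
proof -
  \<comment> \<open>The summand \<open>e\<close> pays for the intervals tagged in the null set, and
    \<open>e * (b - a)\<close> for all the others.\<close>
  have bound: "\<phi> b - \<phi> a \<le> e * (b - a + 1)" if "e > 0" for e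
  proof -
    obtain \<delta> where "\<delta> > 0" and \<delta>: "\<And>\<D>. \<D> division_of \<Union>\<D> \<Longrightarrow> \<Union>\<D> \<subseteq> {a..b} \<Longrightarrow>
        (\<Sum>K\<in>\<D>. Sup K - Inf K) < \<delta> \<Longrightarrow> (\<Sum>K\<in>\<D>. norm (\<phi> (Sup K) - \<phi> (Inf K))) < e"
      using abs_continuous_onE[OF ac \<open>e > 0\<close>] by blast
    obtain Z where Z: "{t. \<not> (t \<in> {a..b} \<longrightarrow>
        (\<exists>d\<le>0. (\<phi> has_real_derivative d) (at t within {a..b})))} \<subseteq> Z"
      and Z0: "emeasure lebesgue Z = 0" "Z \<in> sets lebesgue"
      using AE_E[OF deriv] by auto
    \<comment> \<open>The measure tolerance is the \<delta> of absolute continuity at tolerance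
      \<open>e\<close>. Since \<open>Z\<close> is null, the bound on \<open>U - Z\<close> passes to
      \<open>U\<close>.\<close>
    obtain U where "open U" "Z \<subseteq> U" and UZ: "U - Z \<in> lmeasurable"
      "emeasure lebesgue (U - Z) < ennreal \<delta>"
      using sets_lebesgue_outer_open[OF Z0(2) \<open>\<delta> > 0\<close>] by blast
    have Znull: "Z \<in> null_sets lebesgue"
      using Z0 by (simp add: null_setsI)
    have Usets: "U \<in> sets lebesgue"
      using \<open>open U\<close> by simp
    have Uem: "emeasure lebesgue U < ennreal \<delta>"
      using emeasure_Diff_null_set[OF Znull Usets] UZ(2) by simp
    then have Um: "U \<in> lmeasurable"
      using Usets by (intro fmeasurableI) (auto simp: less_top[symmetric] intro: order.strict_trans)
    have Umeas: "measure lebesgue U < \<delta>"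
      using Uem Um \<open>\<delta> > 0\<close> by (metis emeasure_eq_measure2 ennreal_less_iff measure_nonneg)
    \<comment> \<open>The radius of the gauge: at exceptional tags the ball stays inside
      \<open>U\<close>, at good tags the straddle estimate holds, and at any other \<open>t\<close>
      the radius is arbitrary.\<close>
    have "\<exists>r>0. (t \<in> Z \<longrightarrow> ball t r \<subseteq> U) \<and> (t \<in> {a..b} - Z \<longrightarrow>
        (\<forall>u\<in>{a..b}. \<forall>v\<in>{a..b}. u \<le> t \<and> t \<le> v \<and> t - u < r \<and> v - t < r \<longrightarrow>
          \<phi> v - \<phi> u \<le> e * (v - u)))" for t
    proof (cases "t \<in> Z")
      case True
      with \<open>Z \<subseteq> U\<close> \<open>open U\<close> show ?thesis
        using openE by blast
    next
      case False
      show ?thesis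
      proof (cases "t \<in> {a..b}")
        case True
        with False Z obtain d where "d \<le> 0" "(\<phi> has_real_derivative d) (at t within {a..b})"
          by blast
        then obtain r where "r > 0" "\<And>u v. u \<in> {a..b} \<Longrightarrow> v \<in> {a..b} \<Longrightarrow> u \<le> t \<Longrightarrow> t \<le> v \<Longrightarrow>
            t - u < r \<Longrightarrow> v - t < r \<Longrightarrow> \<phi> v - \<phi> u \<le> e * (v - u)"
          using straddle_upper_bound \<open>e > 0\<close> by metis
        with False show ?thesis by blast
      qed (use False in \<open>auto intro: exI[of _ 1]\<close>)
    qed
    then obtain r where r: "\<And>t. r t > 0" "\<And>t. t \<in> Z \<Longrightarrow> ball t (r t) \<subseteq> U"
      "\<And>t u v. t \<in> {a..b} - Z \<Longrightarrow> u \<in> {a..b} \<Longrightarrow> v \<in> {a..b} \<Longrightarrow> u \<le> t \<Longrightarrow> t \<le> v \<Longrightarrow>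
         t - u < r t \<Longrightarrow> v - t < r t \<Longrightarrow> \<phi> v - \<phi> u \<le> e * (v - u)"
      by metis
    \<comment> \<open>Cousin's lemma: every gauge on a compact interval admits a fine tagged
      division.\<close>
    obtain p where p: "p tagged_division_of {a..b}" and fine: "(\<lambda>t. ball t (r t)) fine p"
      using fine_division_exists_real[of "\<lambda>t. ball t (r t)"] gauge_ball_dependent r(1) by blast
    note finp = tagged_division_of_finite[OF p]
    have piece: "\<exists>u v. K = {u..v} \<and> u \<le> t \<and> t \<le> v \<and> a \<le> u \<and> v \<le> b \<and> {u..v} \<subseteq> ball t (r t)"
      if tK: "(t, K) \<in> p" for t K
    proof -
      obtain u v where "K = {u..v}"
        using tagged_division_ofD(4)[OF p tK] by auto
      moreover have "t \<in> K" "K \<subseteq> {a..b}" "K \<subseteq> ball t (r t)"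
        using tagged_division_ofD(2,3)[OF p tK] fineD[OF fine tK] by auto
      ultimately show ?thesis by auto
    qed
    define q where "q = {(t, K) \<in> p. t \<in> Z}"
    have "q \<subseteq> p" by (auto simp: q_def)
    have qpart: "q tagged_partial_division_of {a..b}"
      using p \<open>q \<subseteq> p\<close> tagged_partial_division_subset tagged_division_of_def by blast
    note qdiv = partial_division_of_tagged_division[OF qpart]
    have "K \<subseteq> {a..b} \<and> K \<subseteq> U \<and> (\<exists>u v. K = {u..v} \<and> u \<le> v)" if K: "K \<in> snd ` q" for K
    proof -
      obtain t where "(t, K) \<in> p" "t \<in> Z"
        using K by (auto simp: q_def)
      moreover from this obtain u v
        where "K = {u..v}" "u \<le> t" "t \<le> v" "a \<le> u" "v \<le> b" "{u..v} \<subseteq> ball t (r t)"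
        using piece by blast
      ultimately show ?thesis
        using r(2)[of t] by (intro conjI exI[of _ u] exI[of _ v]) auto
    qed
    then have qsub: "\<Union>(snd ` q) \<subseteq> {a..b}" "\<Union>(snd ` q) \<subseteq> U"
      and qint: "\<And>K. K \<in> snd ` q \<Longrightarrow> \<exists>u v. K = {u..v} \<and> u \<le> v"
      by blast+
    \<comment> \<open>The intervals have disjoint interiors, so their total length is the measure of
      their union. That union lies in \<open>U\<close>, so the length is below \<delta>.\<close>
    have "(\<Sum>K\<in>snd ` q. Sup K - Inf K) = (\<Sum>K\<in>snd ` q. measure lebesgue K)"
    proof (rule sum.cong)
      fix K assume "K \<in> snd ` q"
      then obtain u v where "K = {u..v}" "u \<le> v"
        using qint by blast
      then show "Sup K - Inf K = measure lebesgue K" by simp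
    qed simp
    also have "\<dots> = measure lebesgue (\<Union>(snd ` q))"
      using qdiv by (rule content_division)
    also have "\<dots> \<le> measure lebesgue U"
      using qsub(2) Um lmeasurable_division[OF qdiv]
      by (intro measure_mono_fmeasurable) (auto simp: fmeasurableD)
    finally have "(\<Sum>K\<in>snd ` q. norm (\<phi> (Sup K) - \<phi> (Inf K))) < e"
      using \<delta>[OF qdiv qsub(1)] Umeas by simp
    \<comment> \<open>Passing from tagged pairs to intervals could merge terms. An interval with two
      different tags has empty interior, hence is a single point with zero increment, so nothing is
      lost.\<close>
    moreover have "(\<Sum>(t, K)\<in>q. norm (\<phi> (Sup K) - \<phi> (Inf K)))
        = (\<Sum>K\<in>snd ` q. norm (\<phi> (Sup K) - \<phi> (Inf K)))"
    proof -
      have degenerate: "norm (\<phi> (Sup K) - \<phi> (Inf K)) = 0"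
        if tK: "(t, K) \<in> q" "(t', K) \<in> q" "t \<noteq> t'" for t t' K
      proof -
        obtain u v where K: "K = {u..v}" "u \<le> v"
          using qint[of K] tK(1) by force
        have "interior K = {}"
          using tagged_partial_division_ofD(5)[OF qpart tK(1,2)] tK(3) by simp
        with K show ?thesis
          by (cases "u = v") auto
      qed
      have "finite q"
        using \<open>q \<subseteq> p\<close> finp by (rule finite_subset)
      moreover have "norm (\<phi> (Sup (snd y)) - \<phi> (Inf (snd y))) = 0"
        if "y \<in> q" "z \<in> q" "y \<noteq> z" "snd y = snd z" for y z
        using that degenerate by (metis prod.collapse)
      ultimately show ?thesis
        by (subst sum.reindex_nontrivial) (auto simp: case_prod_unfold)
    qed
    moreover have "(\<Sum>(t, K)\<in>q. \<phi> (Sup K) - \<phi> (Inf K)) \<le> (\<Sum>(t, K)\<in>q. norm (\<phi> (Sup K) - \<phi> (Inf K)))"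
      by (intro sum_mono) auto
    ultimately have "(\<Sum>(t, K)\<in>q. \<phi> (Sup K) - \<phi> (Inf K)) \<le> e"
      by linarith
    moreover have "(\<Sum>(t, K)\<in>p - q. \<phi> (Sup K) - \<phi> (Inf K)) \<le> (\<Sum>(t, K)\<in>p - q. e * (Sup K - Inf K))"
    proof (intro sum_mono, clarify)
      fix t K assume tK: "(t, K) \<in> p" "(t, K) \<notin> q"
      then obtain u v where K: "K = {u..v}" "u \<le> t" "t \<le> v" "a \<le> u" "v \<le> b" "{u..v} \<subseteq> ball t (r t)"
        using piece by blast
      then have "u \<in> {u..v}" "v \<in> {u..v}"
        by simp_all
      with K have "u \<in> ball t (r t)" "v \<in> ball t (r t)"
        by blast+
      then show "\<phi> (Sup K) - \<phi> (Inf K) \<le> e * (Sup K - Inf K)"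
        using r(3)[of t u v] K tK by (auto simp: q_def dist_real_def)
    qed
    \<comment> \<open>Restoring the pairs of \<open>q\<close> adds only nonnegative lengths; the
      full sum is then \<open>e * (b - a)\<close>.\<close>
    moreover have "\<dots> \<le> (\<Sum>(t, K)\<in>p. e * (Sup K - Inf K))"
      using finp \<open>e > 0\<close> by (intro sum_mono2) (use piece in fastforce)+
    moreover have "\<dots> = e * (\<Sum>(t, K)\<in>p. Sup K - Inf K)"
      by (simp add: sum_distrib_left case_prod_unfold)
    moreover have "(\<Sum>(t, K)\<in>p. Sup K - Inf K) = b - a"
      using additive_tagged_division_1[OF \<open>a \<le> b\<close> p, of "\<lambda>t. t"] by simp
    \<comment> \<open>The increments over the whole division telescope, and the sum splits along
      \<open>q\<close>.\<close>
    moreover have "\<phi> b - \<phi> a = (\<Sum>(t, K)\<in>p - q. \<phi> (Sup K) - \<phi> (Inf K)) + (\<Sum>(t, K)\<in>q. \<phi> (Sup K) - \<phi> (Inf K))"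
      using additive_tagged_division_1[OF \<open>a \<le> b\<close> p, of \<phi>] sum.subset_diff[OF \<open>q \<subseteq> p\<close> finp] by metis
    ultimately show ?thesis by (simp add: distrib_left)
  qed
  have "\<phi> b - \<phi> a \<le> e" if "e > 0" for e
    using bound[of "e / (b - a + 1)"] that \<open>a \<le> b\<close> by simp
  then show ?thesis
    by (metis diff_le_0_iff_le field_le_epsilon add_0)
qed

section \<open>Scalar barrier argument at the last nonpositive time\<close>

text \<open>Apply the previous lemma on \<open>{s..T}\<close>, where \<open>s\<close> is the last time with \<open>\<phi> s \<le> 0\<close>.\<close>

lemma abs_continuous_on_barrier_nonpos:
  fixes \<phi> :: "real \<Rightarrow> real"
  assumes "0 \<le> T" and ac: "\<And>s. s \<in> {0..T} \<Longrightarrow> abs_continuous_on {s..T} \<phi>" and "\<phi> 0 \<le> 0"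
    and deriv: "AE t in lebesgue. t \<in> {0..T} \<longrightarrow>
      (\<exists>d. (\<phi> has_real_derivative d) (at t within {0..T}) \<and> (0 < \<phi> t \<longrightarrow> d \<le> 0))"
  shows "\<phi> T \<le> 0"
proof (rule ccontr)
  assume "\<not> \<phi> T \<le> 0"
  have cont: "continuous_on {0..T} \<phi>"
    using ac[of 0] \<open>0 \<le> T\<close> abs_continuous_on_imp_continuous_on by auto
  define A where "A = {t \<in> {0..T}. \<phi> t \<le> 0}"
  have "closed A"
    unfolding A_def using cont by (intro continuous_on_closed_Collect_le) auto
  then have "compact A"
    by (metis A_def Collect_subset bounded_closed_interval bounded_subset compact_eq_bounded_closed)
  moreover have "A \<noteq> {}"
    using \<open>\<phi> 0 \<le> 0\<close> \<open>0 \<le> T\<close> by (auto simp: A_def)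
  ultimately obtain s where s: "s \<in> A" "\<And>t. t \<in> A \<Longrightarrow> t \<le> s"
    using compact_attains_sup by metis
  have "\<phi> T \<le> \<phi> s"
  proof (rule abs_continuous_on_AE_deriv_nonpos_imp_le[of s T \<phi>])
    show "s \<le> T" "abs_continuous_on {s..T} \<phi>"
      using s(1) ac by (auto simp: A_def)
    \<comment> \<open>At \<open>s\<close> itself the value is nonpositive, so the derivative there
      carries no sign information; a single time is negligible.\<close>
    have "AE t in lebesgue. t \<noteq> s"
      using AE_lborel_singleton by (rule AE_completion)
    with deriv show "AE t in lebesgue. t \<in> {s..T} \<longrightarrow>
        (\<exists>d\<le>0. (\<phi> has_real_derivative d) (at t within {s..T}))"
    proof eventually_elim
      case (elim t)
      show ?case
      proof
        assume "t \<in> {s..T}"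
        with elim(2) s(1) have "t \<in> {0..T}" "s < t"
          by (auto simp: A_def)
        then have "0 < \<phi> t"
          using s(2)[of t] by (force simp: A_def)
        with elim(1) \<open>t \<in> {0..T}\<close> obtain d where "(\<phi> has_real_derivative d) (at t within {0..T})" "d \<le> 0"
          by blast
        then show "\<exists>d\<le>0. (\<phi> has_real_derivative d) (at t within {s..T})"
          using s(1) has_field_derivative_subset[of \<phi> d t "{0..T}" "{s..T}"] by (auto simp: A_def)
      qed
    qed
  qed
  with s(1) \<open>\<not> \<phi> T \<le> 0\<close> show False
    by (simp add: A_def)
qed

section \<open>Lipschitz barriers on compact sets and the eroded control set\<close>

text \<open>The mean value inequality wants a convex domain, and \<open>X\<close> (later an arc of a
  trajectory) need not be convex. A closed ball around it is convex and compact, and the bound on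
  the gradient there is the Lipschitz constant.\<close>

lemma continuous_gradient_imp_lipschitz_on_compact:
  fixes h :: "'a::euclidean_space \<Rightarrow> real"
  assumes diff: "\<And>x. h differentiable at x" and cont: "continuous_on UNIV (gradient h)"
    and "compact X"
  obtains L where "L-lipschitz_on X h"
proof -
  obtain R where R: "X \<subseteq> cball 0 R"
    using compact_imp_bounded[OF \<open>compact X\<close>] bounded_subset_ballD[of X 0] ball_subset_cball by blast
  have "compact (gradient h ` cball 0 R)"
    using cont by (intro compact_continuous_image) (auto intro: continuous_on_subset)
  then obtain B where "B > 0" and B: "\<And>x. x \<in> cball 0 R \<Longrightarrow> norm (gradient h x) \<le> B"
    by (metis bounded_pos compact_imp_bounded imageI)
  have "norm (h x - h y) \<le> B * norm (x - y)" if "x \<in> cball 0 R" "y \<in> cball 0 R" for x y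
  proof (rule differentiable_bound[OF convex_cball _ _ that])
    fix z :: 'a assume z: "z \<in> cball 0 R"
    show "(h has_derivative (\<lambda>v. v \<bullet> gradient h z)) (at z within cball 0 R)"
      using GDERIV_gradient[OF diff] unfolding gderiv_def by (rule has_derivative_at_withinI)
    have "norm (v \<bullet> gradient h z) \<le> B * norm v" for v
      using Cauchy_Schwarz_ineq2[of v "gradient h z"] mult_left_mono[OF B[OF z], of "norm v"]
      by (simp add: mult.commute)
    then show "onorm (\<lambda>v. v \<bullet> gradient h z) \<le> B"
      by (rule onorm_le)
  qed
  then have "B-lipschitz_on X h"
    using R \<open>B > 0\<close> by (intro lipschitz_onI) (auto simp: dist_norm subset_iff)
  then show thesis by (rule that)
qed

text \<open>A point \<open>u\<close> outside \<open>U\<close> equals \<open>u + 0\<close>, hence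
  lies in \<open>(- U) + B\<close>, whose complement is the difference.\<close>

lemma minkowski_diff_subset:
  assumes "0 \<in> B"
  shows "minkowski_diff U B \<subseteq> U"
  using assms unfolding minkowski_diff_def
  by (metis ComplD ComplI add.right_neutral set_plus_intro subsetI)

lemma K_hat_gamma_subset_K_hat:
  fixes A\<^sub>u :: "real^'m^'p"
  assumes "0 < \<gamma>"
  shows "K_hat_gamma A\<^sub>u b\<^sub>u f g N h \<alpha> \<gamma> x \<subseteq> K_hat A\<^sub>u b\<^sub>u f g N h \<alpha> x"
proof -
  have "0 \<in> (*\<^sub>R) \<gamma> ` ball (0::real^'m) 1"
    by (rule image_eqI[of _ _ 0]) auto
  then show ?thesis
    unfolding K_hat_gamma_def using minkowski_diff_subset interior_subset by blast
qed

text \<open>Moving \<open>g x\<close> across the inner product recombines the two Lie derivative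
  terms into the derivative of \<open>h i\<close> along the controlled vector field.\<close>

lemma K_hat_barrier_inequality:
  assumes "u \<in> K_hat A\<^sub>u b\<^sub>u f g N h \<alpha> x" "i \<in> {1..N}"
  shows "(f x + g x *v u) \<bullet> gradient (h i) x \<le> - \<alpha> i (h i x)"
proof -
  have "(gradient (h i) x v* g x) \<bullet> u \<le> - \<alpha> i (h i x) - gradient (h i) x \<bullet> f x"
    using assms unfolding K_hat_def lie_f_def lie_g_def by blast
  then show ?thesis
    by (simp add: dot_lmul_matrix inner_add_right inner_commute[of _ "gradient (h i) x"])
qed

section \<open>Strong invariance of the intersection and of controlled motion\<close>

lemma strongly_invariant_sublevels:
  fixes h :: "nat \<Rightarrow> real^'n \<Rightarrow> real"
  assumes diff: "\<And>i x. i \<in> {1..N} \<Longrightarrow> h i differentiable at x"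
    and cont: "\<And>i. i \<in> {1..N} \<Longrightarrow> continuous_on UNIV (gradient (h i))"
    and \<alpha>: "\<And>i. i \<in> {1..N} \<Longrightarrow> extended_class_K_inf (\<alpha> i)"
    and "0 < \<gamma>"
  shows "strongly_invariant (\<Inter>i\<in>{1..N}. sublevel (h i)) (G_hat_gamma A\<^sub>u b\<^sub>u f g N h \<alpha> \<gamma>)"
  unfolding strongly_invariant_def
proof (intro allI impI ballI INT_I)
  fix J x T i
  assume J: "time_interval J" and x: "inclusion_trajectory (G_hat_gamma A\<^sub>u b\<^sub>u f g N h \<alpha> \<gamma>) J x"
    and x0: "x 0 \<in> (\<Inter>i\<in>{1..N}. sublevel (h i))" and "T \<in> J" and i: "i \<in> {1..N}"
  have "0 \<le> T" and JT: "{0..T} \<subseteq> J"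
    using J \<open>T \<in> J\<close> unfolding time_interval_def is_interval_1 by auto
  have "h i (x T) \<le> 0"
  proof (rule abs_continuous_on_barrier_nonpos[of T "\<lambda>t. h i (x t)", OF \<open>0 \<le> T\<close>])
    show "h i (x 0) \<le> 0"
      using x0 i by (auto simp: sublevel_def)
    show "abs_continuous_on {s..T} (\<lambda>t. h i (x t))" if "s \<in> {0..T}" for s
    proof -
      have "{s..T} \<subseteq> J"
        using JT that by auto
      then have ac: "abs_continuous_on {s..T} x"
        using x unfolding inclusion_trajectory_def loc_abs_continuous_on_def by blast
      \<comment> \<open>Continuity of \<open>x\<close> makes this arc compact, so \<open>h i\<close>
        is Lipschitz on it and the composite inherits absolute continuity.\<close>
      then have "compact (x ` {s..T})"
        by (intro compact_continuous_image abs_continuous_on_imp_continuous_on) auto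
      then show ?thesis
        using continuous_gradient_imp_lipschitz_on_compact[OF diff[OF i] cont[OF i]]
          abs_continuous_on_lipschitz_compose[OF ac] by metis
    qed
    have "AE t in lebesgue. t \<in> J \<longrightarrow>
        (\<exists>v \<in> G_hat_gamma A\<^sub>u b\<^sub>u f g N h \<alpha> \<gamma> (x t). (x has_vector_derivative v) (at t within J))"
      using x by (simp add: inclusion_trajectory_def)
    then show "AE t in lebesgue. t \<in> {0..T} \<longrightarrow>
      (\<exists>d. ((\<lambda>t. h i (x t)) has_real_derivative d) (at t within {0..T}) \<and> (0 < h i (x t) \<longrightarrow> d \<le> 0))"
    proof eventually_elim
      case (elim t)
      show ?case
      proof
        assume "t \<in> {0..T}"
        with elim JT obtain u where u: "u \<in> K_hat_gamma A\<^sub>u b\<^sub>u f g N h \<alpha> \<gamma> (x t)"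
          and dx: "(x has_vector_derivative f (x t) + g (x t) *v u) (at t within J)"
          unfolding G_hat_gamma_def by blast
        let ?v = "f (x t) + g (x t) *v u"
        have "(x has_derivative (\<lambda>s. s *\<^sub>R ?v)) (at t within {0..T})"
          using has_vector_derivative_within_subset[OF dx JT]
          by (simp add: has_vector_derivative_def)
        moreover have "(h i has_derivative (\<lambda>v. v \<bullet> gradient (h i) (x t))) (at (x t))"
          using GDERIV_gradient[OF diff[OF i]] by (simp add: gderiv_def)
        ultimately have "((\<lambda>t. h i (x t)) has_derivative (\<lambda>s. (s *\<^sub>R ?v) \<bullet> gradient (h i) (x t)))
            (at t within {0..T})"
          by (rule has_derivative_compose)
        \<comment> \<open>The chain rule has produced a linear map of the real increment
          \<open>s\<close>; its slope is the required real derivative.\<close>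
        then have "((\<lambda>t. h i (x t)) has_real_derivative ?v \<bullet> gradient (h i) (x t)) (at t within {0..T})"
          by (simp add: has_field_derivative_def mult_commute_abs)
        moreover have "?v \<bullet> gradient (h i) (x t) \<le> - \<alpha> i (h i (x t))"
          using u K_hat_gamma_subset_K_hat[OF \<open>0 < \<gamma>\<close>] i by (intro K_hat_barrier_inequality) blast+
        \<comment> \<open>Strict monotonicity is compared with the value 0 at 0; this makes the
          upper bound on the derivative negative outside the sublevel set.\<close>
        moreover have "0 < \<alpha> i (h i (x t))" if "0 < h i (x t)"
          using \<alpha>[OF i] that unfolding extended_class_K_inf_def by (metis strict_monoD)
        ultimately show "\<exists>d. ((\<lambda>t. h i (x t)) has_real_derivative d) (at t within {0..T}) \<and>
            (0 < h i (x t) \<longrightarrow> d \<le> 0)"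
          by fastforce
      qed
    qed
  qed
  then show "x T \<in> sublevel (h i)"
    by (simp add: sublevel_def)
qed

text \<open>At almost every time, \<open>u t\<close> is itself the witness that the velocity belongs
  to the set of admissible velocities; the two exceptional null sets are united.\<close>

lemma control_trajectory_imp_inclusion_trajectory:
  assumes "control_trajectory f g J u x"
    and "AE t in lebesgue. t \<in> J \<longrightarrow> u t \<in> K_hat_gamma A\<^sub>u b\<^sub>u f g N h \<alpha> \<gamma> (x t)"
  shows "inclusion_trajectory (G_hat_gamma A\<^sub>u b\<^sub>u f g N h \<alpha> \<gamma>) J x"
proof -
  have "AE t in lebesgue. t \<in> J \<longrightarrow> (x has_vector_derivative f (x t) + g (x t) *v u t) (at t within J)"
    using assms(1) by (simp add: control_trajectory_def)
  with assms(2) have "AE t in lebesgue. t \<in> J \<longrightarrow>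
      (\<exists>v \<in> G_hat_gamma A\<^sub>u b\<^sub>u f g N h \<alpha> \<gamma> (x t). (x has_vector_derivative v) (at t within J))"
    by eventually_elim (auto simp: G_hat_gamma_def)
  then show ?thesis
    using assms(1) by (simp add: inclusion_trajectory_def control_trajectory_def)
qed

theorem corollary2:
  fixes f :: "real^'n \<Rightarrow> real^'n"
    and g :: "real^'n \<Rightarrow> real^'m^'n"
    and A\<^sub>u :: "real^'m^'p"
    and b\<^sub>u :: "real^'p"
    and N :: nat
    and h :: "nat \<Rightarrow> real^'n \<Rightarrow> real"
    and \<alpha> :: "nat \<Rightarrow> real \<Rightarrow> real"
    and D S\<^sub>I :: "(real^'n) set"
    and \<gamma> :: real
  assumes "locally_lipschitz f" and "locally_lipschitz g"
    and "compact (input_set A\<^sub>u b\<^sub>u)" and "interior (input_set A\<^sub>u b\<^sub>u) \<noteq> {}"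
    and "\<And>i x. i \<in> {1..N} \<Longrightarrow> h i differentiable at x"
    and "\<And>i. i \<in> {1..N} \<Longrightarrow> continuous_on UNIV (gradient (h i))"
    and "\<And>i. i \<in> {1..N} \<Longrightarrow> locally_lipschitz (gradient (h i))"
    and "\<And>i. i \<in> {1..N} \<Longrightarrow> compact (sublevel (h i))"
    and "\<And>i. i \<in> {1..N} \<Longrightarrow> interior (sublevel (h i)) = {x. h i x < 0}"
    and "\<And>i. i \<in> {1..N} \<Longrightarrow> frontier (sublevel (h i)) = {x. h i x = 0}"
    and "\<And>i. i \<in> {1..N} \<Longrightarrow> strict_cbf (input_set A\<^sub>u b\<^sub>u) f g (h i)"
    and "\<And>i. i \<in> {1..N} \<Longrightarrow> locally_lipschitz (\<alpha> i)"
    and "\<And>i. i \<in> {1..N} \<Longrightarrow> extended_class_K_inf (\<alpha> i)"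
    and S\<^sub>I_def: "S\<^sub>I = (\<Inter>i\<in>{1..N}. sublevel (h i))"
    and "\<And>x i j. x \<in> S\<^sub>I \<Longrightarrow> i \<in> jointly_active N h x \<Longrightarrow> j \<in> jointly_active N h x \<Longrightarrow>
           transversal (sublevel (h i)) (sublevel (h j))"
    and "bounded D" and "open D" and "D \<subseteq> Omega_hat A\<^sub>u b\<^sub>u f g N h \<alpha>" and "S\<^sub>I \<subseteq> D"
    and "0 < \<gamma>" and "\<gamma> < (INF x\<in>D. R_C (K_hat A\<^sub>u b\<^sub>u f g N h \<alpha> x))"
  shows "strongly_invariant S\<^sub>I (G_hat_gamma A\<^sub>u b\<^sub>u f g N h \<alpha> \<gamma>) \<and>
    (\<forall>J u x. time_interval J \<longrightarrow>
       u \<in> borel_measurable (lebesgue_on J) \<longrightarrow>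
       control_trajectory f g J u x \<longrightarrow>
       (AE t in lebesgue. t \<in> J \<longrightarrow> u t \<in> K_hat_gamma A\<^sub>u b\<^sub>u f g N h \<alpha> \<gamma> (x t)) \<longrightarrow>
       x 0 \<in> S\<^sub>I \<longrightarrow>
       (\<forall>t\<in>J. x t \<in> S\<^sub>I))"
proof (intro conjI allI impI)
  show inv: "strongly_invariant S\<^sub>I (G_hat_gamma A\<^sub>u b\<^sub>u f g N h \<alpha> \<gamma>)"
    unfolding S\<^sub>I_def using assms by (intro strongly_invariant_sublevels) auto
  \<comment> \<open>For the open form with an explicit control, the motion is a trajectory of the
    inclusion, so the invariance just shown applies to it.\<close>
  fix J u x
  assume "time_interval J" "control_trajectory f g J u x" "x 0 \<in> S\<^sub>I"
    "AE t in lebesgue. t \<in> J \<longrightarrow> u t \<in> K_hat_gamma A\<^sub>u b\<^sub>u f g N h \<alpha> \<gamma> (x t)"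
  with inv show "\<forall>t\<in>J. x t \<in> S\<^sub>I"
    using control_trajectory_imp_inclusion_trajectory unfolding strongly_invariant_def by blast
qed

end
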